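(* Let $\alpha$ be a smooth null curve in the light cone $\mathcal{LC}$ of $\mathbb E^5_2$ satisfying $\langle\alpha''(t),\alpha''(t)\rangle=\frac49$, and let $M$ be the surface given by $$x(s,t)=\left(\frac 12 s^2+\frac {27}{40}\langle\alpha'''(t), \alpha'''(t)\rangle\right)\alpha(t)+\frac 32 s\,\alpha'(t)+\frac 32\alpha''(t).$$ Put $\eta(t)=\langle\alpha'''(t),\alpha'''(t)\rangle$ and $\xi(t)=\langle\alpha^{(4)}(t),\alpha^{(4)}(t)\rangle$. If $$\frac{27}{40}\eta''(t)-\frac{5103}{1600}\eta^2(t)+\frac{27}{16}\xi(t)=0$$ for all $t$, then $M$ is (locally) congruent to the Lorentzian Veronese surface.
   Context: $\mathbb E^5_2$ is $\mathbb R^5$ with a flat metric $\langle\cdot,\cdot\rangle$ of index $2$ (two negative and three positive directions); $\mathbb S^4_2(1)=\{v\in\mathbb E^5_2:\langle v,v\rangle=1\}$; $\mathcal{LC}=\{v\in\mathbb E^5_2:\langle v,v\rangle=0\}$. A null curve is a smooth curve $\alpha:I\to\mathbb E^5_2$ ($I$ an open interval) with $\alpha'$ everywhere non-zero and $\langle\alpha',\alpha'\rangle=0$; here in addition $\langle\alpha,\alpha\rangle=0$. Lorentzian Veronese surface: let $\mathbb S^2_1(\tfrac13)=\{(x,y,z): x^2+y^2-z^2=3\}$ in $\mathbb E^3_1$ with metric $dx^2+dy^2-dz^2$. The Lorentzian Veronese surface is the image of the isometric immersion $\mathbb S^2_1(\tfrac13)\to\mathbb S^4_2(1)$, $(x,y,z)\mapsto(u_1,\dots,u_5)$,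 $$u_1=\tfrac16(x^2+y^2+2z^2),\quad u_2=\tfrac1{2\sqrt3}(x^2-y^2),\quad u_3=\tfrac1{\sqrt3}xy,\quad u_4=\tfrac1{\sqrt3}xz,\quad u_5=\tfrac1{\sqrt3}yz,$$ where the coordinates of $\mathbb E^5_2$ are ordered so that the metric is $du_1^2+du_2^2+du_3^2-du_4^2-du_5^2$. "Congruent" is meant locally: around each point, a neighbourhood in $M$ is mapped by a linear isometry of $\mathbb E^5_2$ onto an open part of the Lorentzian Veronese surface. *)

theory Defs
  imports "HOL-Analysis.Analysis"
begin

text \<open>The scalar product of \<open>\<bbbE>\<^sup>5\<^sub>2\<close>; the coordinates are ordered so that the
  two negative directions come last.\<close>

definition ip52 :: "real ^ 5 \<Rightarrow> real ^ 5 \<Rightarrow> real" where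
  "ip52 v w = v $ 1 * w $ 1 + v $ 2 * w $ 2 + v $ 3 * w $ 3 - v $ 4 * w $ 4 - v $ 5 * w $ 5"

definition light_cone :: "(real ^ 5) set" where
  "light_cone = {v. ip52 v v = 0}"

definition linear_isometry52 :: "(real ^ 5 \<Rightarrow> real ^ 5) \<Rightarrow> bool" where
  "linear_isometry52 A \<longleftrightarrow> linear A \<and> (\<forall>v w. ip52 (A v) (A w) = ip52 v w)"

definition nth_vderiv :: "nat \<Rightarrow> (real \<Rightarrow> 'a::real_normed_vector) \<Rightarrow> real \<Rightarrow> 'a" where
  "nth_vderiv n f = ((\<lambda>g t. vector_derivative g (at t)) ^^ n) f"

text \<open>Meant for open \<open>I\<close>, where the two-sided derivatives used here only depend on the
  values of the function on \<open>I\<close>.\<close>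

definition smooth_curve_on :: "real set \<Rightarrow> (real \<Rightarrow> 'a::real_normed_vector) \<Rightarrow> bool" where
  "smooth_curve_on I f \<longleftrightarrow> (\<forall>n. \<forall>t\<in>I. nth_vderiv n f differentiable at t)"

definition null_curve_on :: "real set \<Rightarrow> (real \<Rightarrow> real ^ 5) \<Rightarrow> bool" where
  "null_curve_on I \<alpha> \<longleftrightarrow> smooth_curve_on I \<alpha> \<and>
     (\<forall>t\<in>I. nth_vderiv 1 \<alpha> t \<noteq> 0 \<and> ip52 (nth_vderiv 1 \<alpha> t) (nth_vderiv 1 \<alpha> t) = 0)"

text \<open>The pseudosphere \<open>\<bbbS>\<^sup>2\<^sub>1(1/3)\<close> in \<open>\<bbbE>\<^sup>3\<^sub>1\<close>; its curvature is \<open>1/3\<close>, whence the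
  \<open>3\<close> on the right-hand side.\<close>

definition pseudosphere21 :: "(real ^ 3) set" where
  "pseudosphere21 = {p. (p $ 1)\<^sup>2 + (p $ 2)\<^sup>2 - (p $ 3)\<^sup>2 = 3}"

definition veronese_map :: "real ^ 3 \<Rightarrow> real ^ 5" where
  "veronese_map p = (let x = p $ 1; y = p $ 2; z = p $ 3 in vector
     [1 / 6 * (x\<^sup>2 + y\<^sup>2 + 2 * z\<^sup>2),
      1 / (2 * sqrt 3) * (x\<^sup>2 - y\<^sup>2),
      1 / sqrt 3 * (x * y),
      1 / sqrt 3 * (x * z),
      1 / sqrt 3 * (y * z)])"

definition lorentzian_veronese_surface :: "(real ^ 5) set" where
  "lorentzian_veronese_surface = veronese_map ` pseudosphere21"

text \<open>A surface is given by a parametrization \<open>x\<close> on a domain \<open>D\<close>, and neighbourhoods of a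
  point of it are taken in \<open>D\<close>, so that self-intersections of the image do no harm.
  The open parts of \<open>N\<close> are its relatively open subsets; the Veronese map is proper and
  identifies only antipodal points, so on its image these are the images of open subsets
  of the pseudosphere.\<close>

definition locally_congruent52 ::
    "(real \<times> real \<Rightarrow> real ^ 5) \<Rightarrow> (real \<times> real) set \<Rightarrow> (real ^ 5) set \<Rightarrow> bool" where
  "locally_congruent52 x D N \<longleftrightarrow>
     (\<forall>p\<in>D. \<exists>U A. openin (top_of_set D) U \<and> p \<in> U \<and> linear_isometry52 A \<and>
        openin (top_of_set N) (A ` x ` U))"

end

theory Submission
  imports Defs
begin

text \<open>
  The quantity \<open>q = - 9 \<eta> / 80\<close> turns \<open>\<alpha>\<close> into a curve of fourth powers: if \<open>\<gamma>\<close> is a plane curve with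
  \<open>\<gamma>'' = q \<gamma>\<close> and \<open>det (\<gamma>, \<gamma>') = 1\<close>, then \<open>\<alpha>\<close> is congruent to \<open>\<gamma>\<^sup>4 / 18\<close> in the space of binary
  quartic forms with its \<open>SL\<^sub>2\<close>-invariant scalar product. Indeed, derivatives of \<open>\<alpha>\<close> combine to a frame
  \<open>e\<^sub>0, \<dots>, e\<^sub>4\<close> that obeys the equations of the frame \<open>\<gamma>\<^bsup>4-k\<^esup> \<gamma>'\<^bsup>k\<^esup>\<close>. Its Gram matrix is constant, where
  the differential equation for \<open>\<eta>\<close> says precisely that \<open>e\<^sub>4\<close> is null, so that the isometry carrying one
  frame to the other does not depend on \<open>t\<close>. It carries \<open>x(s,t)\<close> to \<open>\<gamma>\<^sup>2 (\<gamma>' + s/6 \<gamma>)\<^sup>2\<close>, and the Veronese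
  map is the squaring of binary quadratic forms, the pseudosphere being the set of products of two
  linear forms of determinant \<open>1\<close>.
\<close>

section \<open>Local solutions of linear differential equations\<close>

text \<open>The Lipschitz bound holds for all states, so the Picard operator contracts the whole
  space of bounded continuous functions. \<open>clamp\<close> extends functions on
  \<open>{a..b}\<close> to the line, so that the fixed point theorem for that type applies. The
  integral from \<open>t0\<close> is a difference of two integrals from \<open>a\<close>, whence the
  factor 2.\<close>

lemma picard_lindelof_global:
  fixes f :: "real \<Rightarrow> 'a::banach \<Rightarrow> 'a"
  assumes cont: "continuous_on ({a..b} \<times> UNIV) (\<lambda>(t, u). f t u)"
    and lip: "\<And>t u v. t \<in> {a..b} \<Longrightarrow> norm (f t u - f t v) \<le> K * norm (u - v)"
    and K: "0 \<le> K" "2 * K * (b - a) < 1" and t0: "t0 \<in> {a..b}"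
  obtains u where "u t0 = c"
    and "\<And>t. t \<in> {a..b} \<Longrightarrow> (u has_vector_derivative f t (u t)) (at t within {a..b})"
proof -
  define J where "J \<equiv> \<lambda>(u::real \<Rightarrow> 'a) t. integral {a..t} (\<lambda>r. f r (u r))"
  define S where "S \<equiv> \<lambda>u t. c + (J u t - J u t0)"
  have cu: "continuous_on {a..b} (\<lambda>r. f r (u r))" if "continuous_on {a..b} u" for u
  proof -
    have "continuous_on {a..b} (\<lambda>r. (r, u r))"
      using that by (intro continuous_intros)
    from continuous_on_compose2[OF cont this] show ?thesis by auto
  qed
  have dS: "(S u has_vector_derivative f t (u t)) (at t within {a..b})"
    if "continuous_on {a..b} u" "t \<in> {a..b}" for u t
  proof -
    have "((\<lambda>s. c + (J u s - J u t0)) has_vector_derivative 0 + (f t (u t) - 0)) (at t within {a..b})"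
      unfolding J_def
      by (intro has_vector_derivative_add has_vector_derivative_diff has_vector_derivative_const
          integral_has_vector_derivative[OF cu[OF that(1)] that(2)])
    then show ?thesis by (simp add: S_def)
  qed
  have cS: "continuous_on (cbox a b) (S u)" if "continuous_on {a..b} u" for u
    unfolding cbox_interval continuous_on_eq_continuous_within
    by (intro ballI has_vector_derivative_continuous[OF dS[OF that]])
  have "\<exists>g :: real \<Rightarrow>\<^sub>C 'a. \<forall>t. g t = S u (clamp a b t)" if "continuous_on {a..b} u" for u
    using continuous_on_cbox_bcontfunE[OF cS[OF that]] by metis
  then have "\<forall>u :: real \<Rightarrow>\<^sub>C 'a. \<exists>g :: real \<Rightarrow>\<^sub>C 'a. \<forall>t. g t = S u (clamp a b t)"
    by simp
  then obtain T :: "(real \<Rightarrow>\<^sub>C 'a) \<Rightarrow> (real \<Rightarrow>\<^sub>C 'a)"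
    where T: "\<And>u t. T u t = S u (clamp a b t)"
    by metis
  have ab: "a \<le> b" using t0 by auto
  have J_diff: "norm (J u t - J v t) \<le> K * dist u v * (b - a)" if t: "t \<in> {a..b}"
    for u v :: "real \<Rightarrow>\<^sub>C 'a" and t
  proof -
    have int: "(\<lambda>r. f r (w r)) integrable_on {a..t}" for w :: "real \<Rightarrow>\<^sub>C 'a"
      using t by (intro integrable_continuous_real continuous_on_subset[OF cu]) auto
    have "norm (J u t - J v t) = norm (integral {a..t} (\<lambda>r. f r (u r) - f r (v r)))"
      unfolding J_def by (simp add: integral_diff int)
    also have "\<dots> \<le> K * dist u v * (t - a)"
    proof (rule integral_bound)
      show "a \<le> t" using t by simp
      show "continuous_on {a..t} (\<lambda>r. f r (u r) - f r (v r))"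
        using t by (intro continuous_intros continuous_on_subset[OF cu]) auto
      fix r assume "r \<in> {a..t}"
      then have "norm (f r (u r) - f r (v r)) \<le> K * norm (u r - v r)"
        using t by (intro lip) auto
      also have "\<dots> \<le> K * dist u v"
        using K dist_bounded[of u r v] by (intro mult_left_mono) (auto simp: dist_norm)
      finally show "norm (f r (u r) - f r (v r)) \<le> K * dist u v" .
    qed
    also have "\<dots> \<le> K * dist u v * (b - a)"
      using t K by (intro mult_left_mono) auto
    finally show ?thesis .
  qed
  have "dist (T u) (T v) \<le> 2 * K * (b - a) * dist u v" for u v
  proof (rule dist_bound)
    fix t
    let ?t = "clamp a b t"
    have t: "?t \<in> {a..b}"
      using clamp_in_interval[of a b t] ab by (simp add: cbox_interval)
    have "dist (T u t) (T v t) = norm ((J u ?t - J v ?t) - (J u t0 - J v t0))"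
      by (simp add: T S_def dist_norm algebra_simps)
    also have "\<dots> \<le> norm (J u ?t - J v ?t) + norm (J u t0 - J v t0)"
      by (rule norm_triangle_ineq4)
    also have "\<dots> \<le> K * dist u v * (b - a) + K * dist u v * (b - a)"
      by (intro add_mono J_diff t t0)
    finally show "dist (T u t) (T v t) \<le> 2 * K * (b - a) * dist u v"
      by (simp add: algebra_simps)
  qed
  then have "\<exists>!u. T u = u"
    using K ab by (intro banach_fix_type[of "2 * K * (b - a)"]) auto
  then obtain u where u: "T u = u" by blast
  have eq: "S u t = u t" if "t \<in> {a..b}" for t
    using T[of u t] that by (simp add: u cbox_interval)
  show thesis
  proof
    show "u t0 = c" using eq[OF t0] by (simp add: S_def)
    fix t assume t: "t \<in> {a..b}"
    show "(u has_vector_derivative f t (u t)) (at t within {a..b})"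
      by (rule has_vector_derivative_transform[OF t _ dS[OF _ t]]) (use eq in auto)
  qed
qed

lemma second_order_linear_ode_local:
  fixes q :: "real \<Rightarrow> real" and c d :: "'a::banach"
  assumes "open I" "continuous_on I q" "t0 \<in> I"
  obtains h u v where "h > 0" "{t0 - h<..<t0 + h} \<subseteq> I" "u t0 = c" "v t0 = d"
    and "\<And>t. t \<in> {t0 - h<..<t0 + h} \<Longrightarrow> (u has_vector_derivative v t) (at t)"
    and "\<And>t. t \<in> {t0 - h<..<t0 + h} \<Longrightarrow> (v has_vector_derivative q t *\<^sub>R u t) (at t)"
proof -
  obtain k where k: "k > 0" "cball t0 k \<subseteq> I"
    using assms open_contains_cball by blast
  have "compact (q ` cball t0 k)"
    by (rule compact_continuous_image[OF continuous_on_subset[OF assms(2) k(2)]]) simp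
  then have "bounded (q ` cball t0 k)" by (rule compact_imp_bounded)
  then obtain Q where Q: "Q > 0" "\<And>t. t \<in> cball t0 k \<Longrightarrow> \<bar>q t\<bar> \<le> Q"
    by (auto simp: bounded_pos)
  \<comment> \<open>With Lipschitz constant \<open>1 + Q\<close> and interval length
    \<open>2 * h\<close>, this keeps the contraction factor at most 1/2.\<close>
  define h where "h = min k (1 / (8 * (1 + Q)))"
  have h: "h > 0" "h \<le> k" "h \<le> 1 / (8 * (1 + Q))" using k Q by (auto simp: h_def)
  have sub: "{t0 - h..t0 + h} \<subseteq> cball t0 k"
    using h by (auto simp: dist_real_def)
  define f where "f \<equiv> \<lambda>t (p :: 'a \<times> 'a). (snd p, q t *\<^sub>R fst p)"
  have "2 * (1 + Q) * (2 * h) \<le> 2 * (1 + Q) * (2 * (1 / (8 * (1 + Q))))"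
    using h Q by (intro mult_left_mono) auto
  also have "\<dots> < 1" using Q by (simp add: field_simps)
  finally have small: "2 * (1 + Q) * ((t0 + h) - (t0 - h)) < 1" by simp
  have cont: "continuous_on ({t0 - h..t0 + h} \<times> UNIV) (\<lambda>(t, u). f t u)"
    unfolding f_def case_prod_beta
    using sub k
    by (intro continuous_intros continuous_on_compose2[OF assms(2)]) auto
  have lip: "norm (f t u - f t v) \<le> (1 + Q) * norm (u - v)" if "t \<in> {t0 - h..t0 + h}" for t u v
  proof -
    let ?w = "u - v"
    have "f t u - f t v = (snd ?w, q t *\<^sub>R fst ?w)"
      by (simp add: f_def scaleR_diff_right)
    then have "norm (f t u - f t v) \<le> norm (snd ?w) + norm (q t *\<^sub>R fst ?w)"
      using norm_Pair_le by metis
    also have "\<dots> \<le> norm ?w + Q * norm ?w"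
    proof (intro add_mono)
      show "norm (snd ?w) \<le> norm ?w" by (metis norm_snd_le prod.collapse)
      have "norm (fst ?w) \<le> norm ?w" by (metis norm_fst_le prod.collapse)
      then show "norm (q t *\<^sub>R fst ?w) \<le> Q * norm ?w"
        using Q(2)[of t] sub that Q(1) unfolding norm_scaleR by (intro mult_mono) auto
    qed
    finally show ?thesis by (simp add: algebra_simps)
  qed
  obtain w where w: "w t0 = (c, d)"
    "\<And>t. t \<in> {t0 - h..t0 + h} \<Longrightarrow> (w has_vector_derivative f t (w t)) (at t within {t0 - h..t0 + h})"
    using picard_lindelof_global[OF cont lip _ small, of t0 "(c, d)"] Q h
    by (auto simp: less_imp_le)
  have dw: "(w has_vector_derivative f t (w t)) (at t)" if "t \<in> {t0 - h<..<t0 + h}" for t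
    using w(2)[of t] that at_within_Icc_at[of "t0 - h" t "t0 + h"] by auto
  show thesis
  proof
    show "h > 0" by fact
    show "{t0 - h<..<t0 + h} \<subseteq> I"
      using sub k by (meson greaterThanLessThan_subseteq_atLeastAtMost_iff order_refl subset_trans)
    show "(fst \<circ> w) t0 = c" "(snd \<circ> w) t0 = d" using w by auto
    fix t assume t: "t \<in> {t0 - h<..<t0 + h}"
    show "((fst \<circ> w) has_vector_derivative (snd \<circ> w) t) (at t)"
      using bounded_linear.has_vector_derivative[OF bounded_linear_fst dw[OF t]]
      by (simp add: f_def o_def)
    show "((snd \<circ> w) has_vector_derivative q t *\<^sub>R (fst \<circ> w) t) (at t)"
      using bounded_linear.has_vector_derivative[OF bounded_linear_snd dw[OF t]]
      by (simp add: f_def o_def)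
  qed
qed

section \<open>Frames of quartic type\<close>

lemma bounded_bilinear_ip52: "bounded_bilinear ip52"
  unfolding bilinear_conv_bounded_bilinear[symmetric] bilinear_def linear_iff
  by (auto simp: ip52_def algebra_simps)

interpretation ip52: bounded_bilinear ip52
  by (rule bounded_bilinear_ip52)

lemma ip52_commute: "ip52 v w = ip52 w v"
  by (simp add: ip52_def mult.commute)

lemmas ip52_linear = ip52.add_left ip52.add_right ip52.diff_left ip52.diff_right
  ip52.scaleR_left ip52.scaleR_right ip52.minus_left ip52.minus_right ip52.zero_left ip52.zero_right

lemma exhaust_5: "x = 1 \<or> x = 2 \<or> x = 3 \<or> x = 4 \<or> x = 5" for x :: 5
proof (induct x)
  case (of_int z)
  then have "z = 0 \<or> z = 1 \<or> z = 2 \<or> z = 3 \<or> z = 4" by fastforce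
  then show ?case by auto
qed

lemma forall_5: "(\<forall>i::5. P i) \<longleftrightarrow> P 1 \<and> P 2 \<and> P 3 \<and> P 4 \<and> P 5"
  by (metis exhaust_5)

lemma vector_5:
  "(vector [a, b, c, d, e] :: 'a::zero ^ 5) $ 1 = a"
  "(vector [a, b, c, d, e] :: 'a::zero ^ 5) $ 2 = b"
  "(vector [a, b, c, d, e] :: 'a::zero ^ 5) $ 3 = c"
  "(vector [a, b, c, d, e] :: 'a::zero ^ 5) $ 4 = d"
  "(vector [a, b, c, d, e] :: 'a::zero ^ 5) $ 5 = e"
  unfolding vector_def by simp_all

lemma atMost_4: "{..4::nat} = {0, 1, 2, 3, 4}"
  by (rule set_eqI) (simp, arith)

lemma all_le_4: "(\<forall>k\<le>4. P k) \<longleftrightarrow> P 0 \<and> P 1 \<and> P 2 \<and> P 3 \<and> P (4::nat)"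
proof -
  have "(\<forall>k\<le>4. P k) \<longleftrightarrow> (\<forall>k\<in>{..4}. P k)" by (simp only: Ball_def atMost_iff)
  then show ?thesis unfolding atMost_4 by simp
qed

lemma sum_le_4: "sum f {..4::nat} = f 0 + f 1 + f 2 + f 3 + f 4"
  unfolding atMost_4 by (simp add: ac_simps)

lemma choose_4: "4 choose 0 = 1" "4 choose 1 = 4" "4 choose 2 = 6" "4 choose 3 = 4" "4 choose 4 = 1"
  by (simp_all add: numeral_eq_Suc)

text \<open>The products of the basis \<open>X\<^bsup>4-k\<^esup> Y\<^bsup>k\<^esup>\<close> of the binary quartic forms under the invariant
  (apolar) scalar product.\<close>

definition apolar_basis :: "real \<Rightarrow> (nat \<Rightarrow> real ^ 5) \<Rightarrow> bool" where
  "apolar_basis \<kappa> e \<longleftrightarrow> (\<forall>j\<le>4. \<forall>k\<le>4. ip52 (e j) (e k) =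
     (if j + k = 4 then \<kappa> * (- 1) ^ j / real (4 choose j) else 0))"

lemma apolar_basis_iff:
  "apolar_basis \<kappa> e \<longleftrightarrow>
     ip52 (e 0) (e 0) = 0 \<and> ip52 (e 0) (e 1) = 0 \<and> ip52 (e 0) (e 2) = 0 \<and>
     ip52 (e 0) (e 3) = 0 \<and> ip52 (e 0) (e 4) = \<kappa> \<and> ip52 (e 1) (e 1) = 0 \<and>
     ip52 (e 1) (e 2) = 0 \<and> ip52 (e 1) (e 3) = - \<kappa> / 4 \<and> ip52 (e 1) (e 4) = 0 \<and>
     ip52 (e 2) (e 2) = \<kappa> / 6 \<and> ip52 (e 2) (e 3) = 0 \<and> ip52 (e 2) (e 4) = 0 \<and>
     ip52 (e 3) (e 3) = 0 \<and> ip52 (e 3) (e 4) = 0 \<and> ip52 (e 4) (e 4) = 0"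
  unfolding apolar_basis_def all_le_4
  by (auto simp: choose_4[simplified] ip52_commute[of "e 4" "e 3"] ip52_commute[of "e 4" "e 2"]
      ip52_commute[of "e 4" "e (Suc 0)"] ip52_commute[of "e 4" "e 0"] ip52_commute[of "e 3" "e 2"]
      ip52_commute[of "e 3" "e (Suc 0)"] ip52_commute[of "e 3" "e 0"]
      ip52_commute[of "e 2" "e (Suc 0)"] ip52_commute[of "e 2" "e 0"]
      ip52_commute[of "e (Suc 0)" "e 0"])

lemma apolar_basisD:
  "\<lbrakk>apolar_basis \<kappa> e; j \<le> 4; k \<le> 4\<rbrakk> \<Longrightarrow> ip52 (e j) (e k) =
     (if j + k = 4 then \<kappa> * (- 1) ^ j / real (4 choose j) else 0)"
  by (simp add: apolar_basis_def)

section \<open>Linear maps between apolar bases\<close>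

text \<open>Up to the factor \<open>\<kappa>\<close>, the signed binomial multiples of
  \<open>e (4 - k)\<close> form the dual basis of an apolar basis. Without division by
  \<open>\<kappa>\<close> the map makes sense for arbitrary frames.\<close>

definition frame_map :: "(nat \<Rightarrow> real ^ 5) \<Rightarrow> (nat \<Rightarrow> real ^ 5) \<Rightarrow> real ^ 5 \<Rightarrow> real ^ 5" where
  "frame_map e E v = (\<Sum>k\<le>4. ((- 1) ^ k * real (4 choose k) * ip52 v (e (4 - k))) *\<^sub>R E k)"

lemma frame_map_expand:
  "frame_map e E v = ip52 v (e 4) *\<^sub>R E 0 - (4 * ip52 v (e 3)) *\<^sub>R E 1 + (6 * ip52 v (e 2)) *\<^sub>R E 2
     - (4 * ip52 v (e 1)) *\<^sub>R E 3 + ip52 v (e 0) *\<^sub>R E 4"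
  by (simp add: frame_map_def sum_le_4 choose_4[simplified])

lemma linear_frame_map: "linear (frame_map e E)"
  by (simp add: linear_iff frame_map_expand ip52_linear algebra_simps)

lemma frame_map_basis:
  assumes "apolar_basis \<kappa> e"
  shows "frame_map e E (e 0) = \<kappa> *\<^sub>R E 0" "frame_map e E (e 1) = \<kappa> *\<^sub>R E 1"
    "frame_map e E (e 2) = \<kappa> *\<^sub>R E 2" "frame_map e E (e 3) = \<kappa> *\<^sub>R E 3"
    "frame_map e E (e 4) = \<kappa> *\<^sub>R E 4"
  by (simp_all add: frame_map_expand apolar_basisD[OF assms] choose_4[simplified])

text \<open>The Gram matrix is nondegenerate, so the five vectors are independent and, by dimension,
  span; on them the claim is \<open>frame_map_basis\<close>.\<close>

lemma frame_map_self:
  assumes e: "apolar_basis \<kappa> e" and "\<kappa> \<noteq> 0"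
  shows "frame_map e e v = \<kappa> *\<^sub>R v"
proof -
  define \<psi> where "\<psi> \<equiv> \<lambda>c :: real ^ 5. c $ 1 *\<^sub>R e 0 + c $ 2 *\<^sub>R e 1 + c $ 3 *\<^sub>R e 2
    + c $ 4 *\<^sub>R e 3 + c $ 5 *\<^sub>R e 4"
  have lin: "linear \<psi>"
    by (simp add: linear_iff \<psi>_def algebra_simps)
  have "inj \<psi>"
  proof (subst linear_injective_0[OF lin], intro allI impI)
    fix c assume "\<psi> c = 0"
    then have "ip52 (\<psi> c) (e k) = 0" for k by (simp add: ip52_linear)
    from this[of 0] this[of 1] this[of 2] this[of 3] this[of 4] show "c = 0"
      using \<open>\<kappa> \<noteq> 0\<close>
      by (simp add: \<psi>_def ip52_linear vec_eq_iff forall_5 apolar_basisD[OF e]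
        choose_4[simplified])
  qed
  then have "surj \<psi>"
    using lin by (simp add: linear_injective_imp_surjective)
  then obtain c where "v = \<psi> c" by blast
  then show ?thesis
    by (simp add: \<psi>_def linear_add[OF linear_frame_map] linear_scale[OF linear_frame_map]
        frame_map_basis[OF e] frame_map_basis(2)[OF e, simplified] scaleR_add_right mult.commute)
qed

lemma apolar_basis_nondegenerate:
  assumes "apolar_basis \<kappa> e" "\<kappa> \<noteq> 0" "\<forall>k\<le>4. ip52 v (e k) = 0"
  shows "v = 0"
proof -
  have "\<kappa> *\<^sub>R v = 0"
    using assms(3) unfolding frame_map_self[OF assms(1,2), symmetric] all_le_4
    by (simp add: frame_map_expand)
  then show ?thesis using \<open>\<kappa> \<noteq> 0\<close> by simp
qed

text \<open>The Gram matrices of \<open>e\<close> and \<open>E\<close> are proportional. A multiple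
  of the map by \<open>c\<close> with \<open>c\<^sup>2 * \<kappa> * \<mu> = 1\<close> is thus an
  isometry.\<close>

lemma ip52_frame_map:
  assumes e: "apolar_basis \<kappa> e" "\<kappa> \<noteq> 0" and E: "apolar_basis \<mu> E"
  shows "ip52 (frame_map e E v) (frame_map e E w) = \<kappa> * \<mu> * ip52 v w"
proof -
  have "ip52 (frame_map e E v) (frame_map e E w) = \<mu> * ip52 v (frame_map e e w)"
    by (simp add: frame_map_expand ip52_linear apolar_basisD[OF E] choose_4[simplified])
      (simp add: algebra_simps)
  then show ?thesis by (simp add: frame_map_self[OF e] ip52_linear)
qed

text \<open>The differential equations of \<open>e k = \<gamma>\<^bsup>4-k\<^esup> \<gamma>'\<^bsup>k\<^esup>\<close> when \<open>\<gamma>'' = q \<gamma>\<close>. At the ends \<open>k = 0\<close> and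
  \<open>k = 4\<close> the out-of-range neighbour has coefficient \<open>0\<close>.\<close>

definition quartic_frame :: "real set \<Rightarrow> (real \<Rightarrow> real) \<Rightarrow> (nat \<Rightarrow> real \<Rightarrow> real ^ 5) \<Rightarrow> bool" where
  "quartic_frame J q e \<longleftrightarrow> (\<forall>t\<in>J. \<forall>k\<le>4.
     (e k has_vector_derivative (4 - real k) *\<^sub>R e (k + 1) t + (real k * q t) *\<^sub>R e (k - 1) t) (at t))"

lemma quartic_frame_iff:
  "quartic_frame J q e \<longleftrightarrow> (\<forall>t\<in>J.
     (e 0 has_vector_derivative 4 *\<^sub>R e 1 t) (at t) \<and>
     (e 1 has_vector_derivative 3 *\<^sub>R e 2 t + q t *\<^sub>R e 0 t) (at t) \<and>
     (e 2 has_vector_derivative 2 *\<^sub>R e 3 t + (2 * q t) *\<^sub>R e 1 t) (at t) \<and>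
     (e 3 has_vector_derivative e 4 t + (3 * q t) *\<^sub>R e 2 t) (at t) \<and>
     (e 4 has_vector_derivative (4 * q t) *\<^sub>R e 3 t) (at t))"
proof -
  have idx: "(0::nat) + 1 = 1" "(1::nat) + 1 = 2" "(2::nat) + 1 = 3" "(3::nat) + 1 = 4"
    "(1::nat) - 1 = 0" "(2::nat) - 1 = 1" "(3::nat) - 1 = 2" "(4::nat) - 1 = 3"
    by simp_all
  show ?thesis
    unfolding quartic_frame_def all_le_4 idx by simp
qed

text \<open>The signed binomial multiples of \<open>e (4 - k)\<close> solve the adjoint of the
  linear system obeyed by \<open>E\<close>, so the terms of the derivative cancel in pairs.\<close>

lemma frame_map_constant:
  assumes J: "convex J" and e: "quartic_frame J q e" and E: "quartic_frame J q E"
    and "s \<in> J" "t \<in> J"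
  shows "frame_map (\<lambda>k. e k s) (\<lambda>k. E k s) v = frame_map (\<lambda>k. e k t) (\<lambda>k. E k t) v"
proof (rule has_derivative_zero_unique[OF J _ \<open>s \<in> J\<close> \<open>t \<in> J\<close>])
  fix r assume r: "r \<in> J"
  note de = e[unfolded quartic_frame_iff, rule_format, OF r]
    and dE = E[unfolded quartic_frame_iff, rule_format, OF r]
  have dip: "((\<lambda>t. ip52 v (f t)) has_vector_derivative ip52 v f') (at r)"
    if "(f has_vector_derivative f') (at r)" for f f'
    by (rule bounded_linear.has_vector_derivative[OF ip52.bounded_linear_right that])
  have dprod: "((\<lambda>t. (c * ip52 v (f t)) *\<^sub>R g t) has_vector_derivative
      ((c * ip52 v f') *\<^sub>R g r + (c * ip52 v (f r)) *\<^sub>R g')) (at r)"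
    if "(f has_vector_derivative f') (at r)" "(g has_vector_derivative g') (at r)" for c f f' and g :: "real \<Rightarrow> real ^ 5" and g'
  proof -
    have "((\<lambda>t. c * ip52 v (f t)) has_field_derivative c * ip52 v f') (at r)"
      using dip[OF that(1)]
      unfolding has_real_derivative_iff_has_vector_derivative
      by (rule has_vector_derivative_mult_right)
    from has_vector_derivative_scaleR[OF this that(2)] show ?thesis by (simp add: add.commute)
  qed
  from de dE have d:
    "(e 0 has_vector_derivative 4 *\<^sub>R e 1 r) (at r)"
    "(e 1 has_vector_derivative 3 *\<^sub>R e 2 r + q r *\<^sub>R e 0 r) (at r)"
    "(e 2 has_vector_derivative 2 *\<^sub>R e 3 r + (2 * q r) *\<^sub>R e 1 r) (at r)"
    "(e 3 has_vector_derivative e 4 r + (3 * q r) *\<^sub>R e 2 r) (at r)"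
    "(e 4 has_vector_derivative (4 * q r) *\<^sub>R e 3 r) (at r)"
    "(E 0 has_vector_derivative 4 *\<^sub>R E 1 r) (at r)"
    "(E 1 has_vector_derivative 3 *\<^sub>R E 2 r + q r *\<^sub>R E 0 r) (at r)"
    "(E 2 has_vector_derivative 2 *\<^sub>R E 3 r + (2 * q r) *\<^sub>R E 1 r) (at r)"
    "(E 3 has_vector_derivative E 4 r + (3 * q r) *\<^sub>R E 2 r) (at r)"
    "(E 4 has_vector_derivative (4 * q r) *\<^sub>R E 3 r) (at r)"
    by blast+
  have eq: "(\<lambda>t. frame_map (\<lambda>k. e k t) (\<lambda>k. E k t) v) =
      (\<lambda>t. (1 * ip52 v (e 4 t)) *\<^sub>R E 0 t + (- 4 * ip52 v (e 3 t)) *\<^sub>R E 1 t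
        + (6 * ip52 v (e 2 t)) *\<^sub>R E 2 t + (- 4 * ip52 v (e 1 t)) *\<^sub>R E 3 t
        + (1 * ip52 v (e 0 t)) *\<^sub>R E 4 t)"
    by (simp add: frame_map_expand)
  have "((\<lambda>t. frame_map (\<lambda>k. e k t) (\<lambda>k. E k t) v) has_vector_derivative 0) (at r)"
    unfolding eq
    by (rule has_vector_derivative_eq_rhs, (rule has_vector_derivative_add dprod d)+)
      (simp add: ip52_linear algebra_simps)
  then show "((\<lambda>t. frame_map (\<lambda>k. e k t) (\<lambda>k. E k t) v) has_derivative (\<lambda>h. 0)) (at r within J)"
    by (simp add: has_vector_derivative_def has_derivative_at_withinI)
qed

text \<open>Repeated differentiation of the three norm conditions gives all products of
  \<open>a 0, ..., a 4\<close> except those among \<open>a 3\<close>, \<open>a 4\<close>, and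
  \<open>g 2 4\<close> in terms of \<open>g 3 3\<close>. The choice of \<open>q\<close> makes
  \<open>e 3\<close> null, and \<open>curv\<close> makes \<open>e 4\<close> null. The constant
  \<open>1 / 54\<close> is six times \<open>ip52 (e 2 t) (e 2 t) = 1 / 324\<close>.\<close>

lemma quartic_frame_of_null_curve:
  fixes a :: "nat \<Rightarrow> real \<Rightarrow> real ^ 5"
  assumes "open J" and da: "\<And>n t. t \<in> J \<Longrightarrow> (a n has_vector_derivative a (Suc n) t) (at t)"
    and g00: "\<And>t. t \<in> J \<Longrightarrow> ip52 (a 0 t) (a 0 t) = 0"
    and g11: "\<And>t. t \<in> J \<Longrightarrow> ip52 (a 1 t) (a 1 t) = 0"
    and g22: "\<And>t. t \<in> J \<Longrightarrow> ip52 (a 2 t) (a 2 t) = 4 / 9"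
    and curv: "\<And>t. t \<in> J \<Longrightarrow> 27 / 40 * (2 * ip52 (a 4 t) (a 4 t) + 2 * ip52 (a 3 t) (a 5 t))
      - 5103 / 1600 * (ip52 (a 3 t) (a 3 t))\<^sup>2 + 27 / 16 * ip52 (a 4 t) (a 4 t) = 0"
    and q_def: "q = (\<lambda>t. - 9 / 80 * ip52 (a 3 t) (a 3 t))"
  obtains e where "quartic_frame J q e" "\<And>t. t \<in> J \<Longrightarrow> apolar_basis (1 / 54) (\<lambda>k. e k t)"
    and "\<And>t. t \<in> J \<Longrightarrow> a 0 t = e 0 t" "\<And>t. t \<in> J \<Longrightarrow> a 1 t = 4 *\<^sub>R e 1 t"
    and "\<And>t. t \<in> J \<Longrightarrow> a 2 t = 12 *\<^sub>R e 2 t + (4 * q t) *\<^sub>R e 0 t"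
proof -
  define g where "g \<equiv> \<lambda>j k t. ip52 (a j t) (a k t)"
  have g: "ip52 (a j t) (a k t) = g j k t" for j k t by (simp add: g_def)
  have sym: "g j k t = g k j t" for j k t by (simp add: g_def ip52_commute)
  have dg: "(g j k has_real_derivative g j (Suc k) t + g (Suc j) k t) (at t)" if "t \<in> J" for j k t
    unfolding has_real_derivative_iff_has_vector_derivative g_def
    by (rule ip52.has_vector_derivative[OF da[OF that] da[OF that]])
  \<comment> \<open>Differentiating an identity between products yields one of the next order; as
    \<open>J\<close> is open, equality on \<open>J\<close> suffices.\<close>
  have step: "g j (Suc k) t + g (Suc j) k t = F'"
    if "\<And>t. t \<in> J \<Longrightarrow> g j k t = F t" "t \<in> J" "(F has_real_derivative F') (at t)" for j k t F F'
  proof (rule DERIV_unique[OF dg[OF that(2)]])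
    show "(g j k has_real_derivative F') (at t)"
      by (rule has_field_derivative_transform_within_open[OF that(3) \<open>open J\<close> that(2)])
        (simp add: that(1))
  qed
  have const: "g j (Suc k) t = - g (Suc j) k t" if "\<And>t. t \<in> J \<Longrightarrow> g j k t = c" "t \<in> J" for j k t c
    using step[of j k "\<lambda>_. c" t 0] that by (simp add: eq_neg_iff_add_eq_0)
  have g0: "g 0 0 t = 0" "g 1 1 t = 0" "g 2 2 t = 4 / 9" if "t \<in> J" for t
    using g00 g11 g22 that by (auto simp: g_def)
  have g01: "g 0 1 t = 0" if "t \<in> J" for t
    using const[of 0 0 0 t] g0 that sym[of 0 1 t] by simp
  have g12: "g 1 2 t = 0" if "t \<in> J" for t
    using const[of 1 1 0 t] g0 that sym[of 1 2 t] by (simp add: numeral_2_eq_2)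
  have g23: "g 2 3 t = 0" if "t \<in> J" for t
    using const[of 2 2 "4/9" t] g0 that sym[of 2 3 t] by (simp add: numeral_3_eq_3 numeral_2_eq_2)
  have g02: "g 0 2 t = 0" if "t \<in> J" for t
    using const[of 0 1 0 t] g0 g01 that by (simp add: numeral_2_eq_2)
  have g03: "g 0 3 t = 0" if "t \<in> J" for t
    using const[of 0 2 0 t] g02 g12 that by (simp add: numeral_3_eq_3 numeral_2_eq_2)
  have g13: "g 1 3 t = - 4 / 9" if "t \<in> J" for t
    using const[of 1 2 0 t] g0(3) g12 that by (simp add: numeral_3_eq_3 numeral_2_eq_2)
  have g04: "g 0 4 t = 4 / 9" if "t \<in> J" for t
    using const[of 0 3 0 t] g03 g13 that by (simp add: numeral_eq_Suc)
  have g14: "g 1 4 t = 0" if "t \<in> J" for t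
    using const[of 1 3 "- 4 / 9" t] g23 g13 that by (simp add: numeral_eq_Suc)
  have g24: "g 2 4 t = - g 3 3 t" if "t \<in> J" for t
    using const[of 2 3 0 t] g23 that by (simp add: numeral_eq_Suc)
  note G = g0 g01 g12 g23 g02 g03 g13 g04 g14 g24

  have dg': "(g 3 3 has_real_derivative 2 * g 3 4 t) (at t)"
    "(g 3 4 has_real_derivative g 3 5 t + g 4 4 t) (at t)"
    "(g 4 4 has_real_derivative 2 * g 4 5 t) (at t)"
    "(g 3 5 has_real_derivative g 3 6 t + g 4 5 t) (at t)" if "t \<in> J" for t
    using dg[OF that, of 3 3] dg[OF that, of 3 4] dg[OF that, of 4 4] dg[OF that, of 3 5]
    by (simp_all add: sym[of 4 3] sym[of 5 4])
  \<comment> \<open>The derivatives of \<open>q\<close> as products of the \<open>a n\<close>;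
    \<open>q3\<close> enters because \<open>e 4\<close> contains \<open>q2\<close> and has to be
    differentiable.\<close>
  define q1 where "q1 \<equiv> \<lambda>t. - 9 / 40 * g 3 4 t"
  define q2 where "q2 \<equiv> \<lambda>t. - 9 / 40 * (g 4 4 t + g 3 5 t)"
  define q3 where "q3 \<equiv> \<lambda>t. - 9 / 40 * (3 * g 4 5 t + g 3 6 t)"
  have dq: "(q has_real_derivative q1 t) (at t)" "(q1 has_real_derivative q2 t) (at t)"
    "(q2 has_real_derivative q3 t) (at t)" if "t \<in> J" for t
    unfolding q_def q1_def q2_def q3_def g
    by (rule DERIV_cong, (rule DERIV_cmult DERIV_add dg'[OF that])+, simp)+
  txt \<open>The frame is found by solving the first four equations of \<open>quartic_frame\<close> successively for
    \<open>e 1, \<dots>, e 4\<close>; the fifth one then follows from the Gram matrix.\<close>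
  define e where "e \<equiv> \<lambda>k::nat. if k = 0 then a 0 else if k = 1 then (\<lambda>t. (1 / 4) *\<^sub>R a 1 t)
    else if k = 2 then (\<lambda>t. (1 / 12) *\<^sub>R a 2 t + (- (1 / 3) * q t) *\<^sub>R a 0 t)
    else if k = 3 then (\<lambda>t. (1 / 24) *\<^sub>R a 3 t + (- (1 / 6) * q1 t) *\<^sub>R a 0 t + (- (5 / 12) * q t) *\<^sub>R a 1 t)
    else (\<lambda>t. (1 / 24) *\<^sub>R a 4 t + (- (2 / 3) * q t) *\<^sub>R a 2 t + (- (7 / 12) * q1 t) *\<^sub>R a 1 t
      + ((q t)\<^sup>2 - 1 / 6 * q2 t) *\<^sub>R a 0 t)"
  have e: "e 0 = a 0" "e 1 = (\<lambda>t. (1 / 4) *\<^sub>R a 1 t)"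
    "e 2 = (\<lambda>t. (1 / 12) *\<^sub>R a 2 t + (- (1 / 3) * q t) *\<^sub>R a 0 t)"
    "e 3 = (\<lambda>t. (1 / 24) *\<^sub>R a 3 t + (- (1 / 6) * q1 t) *\<^sub>R a 0 t + (- (5 / 12) * q t) *\<^sub>R a 1 t)"
    "e 4 = (\<lambda>t. (1 / 24) *\<^sub>R a 4 t + (- (2 / 3) * q t) *\<^sub>R a 2 t + (- (7 / 12) * q1 t) *\<^sub>R a 1 t
      + ((q t)\<^sup>2 - 1 / 6 * q2 t) *\<^sub>R a 0 t)"
    by (simp_all add: e_def)
  have da': "(a 0 has_vector_derivative a 1 t) (at t)" "(a 1 has_vector_derivative a 2 t) (at t)"
    "(a 2 has_vector_derivative a 3 t) (at t)" "(a 3 has_vector_derivative a 4 t) (at t)"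
    "(a 4 has_vector_derivative a 5 t) (at t)" if "t \<in> J" for t
    using da[OF that, of 0] da[OF that, of 1] da[OF that, of 2] da[OF that, of 3] da[OF that, of 4]
    by (simp_all add: eval_nat_numeral)
  have dsc: "((\<lambda>t. (c * f t) *\<^sub>R v t) has_vector_derivative (c * f t) *\<^sub>R v' + (c * f') *\<^sub>R v t) (at t)"
    if "(f has_real_derivative f') (at t)" "(v has_vector_derivative v') (at t)"
    for c f f' v' t and v :: "real \<Rightarrow> real ^ 5"
    by (rule has_vector_derivative_scaleR[OF DERIV_cmult[OF that(1)] that(2)])
  have dcs: "((\<lambda>t. c *\<^sub>R v t) has_vector_derivative c *\<^sub>R v') (at t)"
    if "(v has_vector_derivative v') (at t)" for c t v' and v :: "real \<Rightarrow> real ^ 5"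
    by (rule bounded_linear.has_vector_derivative[OF bounded_linear_scaleR_right that])
  have d: "(e 0 has_vector_derivative 4 *\<^sub>R e 1 t) (at t)"
    "(e 1 has_vector_derivative 3 *\<^sub>R e 2 t + q t *\<^sub>R e 0 t) (at t)"
    "(e 2 has_vector_derivative 2 *\<^sub>R e 3 t + (2 * q t) *\<^sub>R e 1 t) (at t)"
    "(e 3 has_vector_derivative e 4 t + (3 * q t) *\<^sub>R e 2 t) (at t)" if t: "t \<in> J" for t
    unfolding e
    by (rule has_vector_derivative_eq_rhs,
      (rule has_vector_derivative_add dcs dsc da'[OF t] dq[OF t])+,
      simp add: vec_eq_iff field_simps power2_eq_square)+
  have "\<exists>D. (e 4 has_vector_derivative D) (at t)" if t: "t \<in> J" for t
  proof -
    have "((\<lambda>t. (q t)\<^sup>2 - 1 / 6 * q2 t) has_real_derivative 2 * q t * q1 t - 1 / 6 * q3 t) (at t)"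
      by (rule derivative_eq_intros dq[OF t] refl | simp)+
    note d0 = has_vector_derivative_scaleR[OF this da'(1)[OF t]]
    show ?thesis
      unfolding e
      by (rule exI, (rule has_vector_derivative_add dcs dsc d0 da'[OF t] dq[OF t])+)
  qed
  then obtain D where D: "\<And>t. t \<in> J \<Longrightarrow> (e 4 has_vector_derivative D t) (at t)"
    by metis
  have g34: "g 3 4 t = - 40 / 9 * q1 t" and g33: "g 3 3 t = - 80 / 9 * q t" for t
    by (simp_all add: q1_def q_def g_def)
  \<comment> \<open>This is \<open>curv\<close> solved for the product, giving exactly the value for
    which \<open>e 4\<close> is null.\<close>
  have g44: "g 4 4 t = 448 / 3 * (q t)\<^sup>2 + 32 / 9 * q2 t" if "t \<in> J" for t
    using curv[OF that] unfolding q_def q2_def g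
    by (simp add: power2_eq_square algebra_simps)
  have ap: "apolar_basis (1 / 54) (\<lambda>k. e k t)" if t: "t \<in> J" for t
    unfolding apolar_basis_iff e
    by (intro conjI; simp only: ip52_linear g sym[of 1 0] sym[of 2 0] sym[of 3 0] sym[of 4 0]
        sym[of 2 1] sym[of 3 1] sym[of 4 1] sym[of 3 2] sym[of 4 2] sym[of 4 3]
        G[OF t] g34 g33 g44[OF t]; simp add: field_simps power2_eq_square)
  have "D t = (4 * q t) *\<^sub>R e 3 t" if t: "t \<in> J" for t
  proof -
    \<comment> \<open>The products of \<open>e 4\<close> with the frame are constant. Together with
      the known derivatives of \<open>e 0, ..., e 3\<close> this fixes the products of
      \<open>D t\<close> with all frame vectors, hence \<open>D t\<close> itself by
      nondegeneracy.\<close>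
    have orth: "ip52 (e 4 t) f' + ip52 (D t) (e k t) = 0"
      if k: "k \<le> 4" and f: "(e k has_vector_derivative f') (at t)" for k f'
    proof (rule vector_derivative_unique_at)
      show "((\<lambda>t. ip52 (e 4 t) (e k t)) has_vector_derivative
          ip52 (e 4 t) f' + ip52 (D t) (e k t)) (at t)"
        by (rule ip52.has_vector_derivative[OF D[OF t] f])
      show "((\<lambda>t. ip52 (e 4 t) (e k t)) has_vector_derivative 0) (at t)"
        by (rule has_vector_derivative_transform_within_open[OF has_vector_derivative_const \<open>open J\<close> t])
          (use k in \<open>simp add: apolar_basisD[OF ap, of _ 4 k]\<close>)
    qed
    note ip = apolar_basisD[OF ap[OF t]]
    have "D t - (4 * q t) *\<^sub>R e 3 t = 0"
    proof (rule apolar_basis_nondegenerate[OF ap[OF t]])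
      show "\<forall>k\<le>4. ip52 (D t - (4 * q t) *\<^sub>R e 3 t) (e k t) = 0"
        using orth[of 0, OF _ d(1)[OF t]] orth[of 1, OF _ d(2)[OF t]] orth[of 2, OF _ d(3)[OF t]]
          orth[of 3, OF _ d(4)[OF t]] orth[of 4, OF _ D[OF t]]
        unfolding all_le_4
        by (simp add: ip52_linear ip ip[of _ 1, simplified] choose_4[simplified] ip52_commute[of "e 4 t" "D t"])
    qed simp
    then show ?thesis by simp
  qed
  with D d have "quartic_frame J q e" by (simp add: quartic_frame_iff)
  then show thesis
    using ap by (rule that) (unfold e, simp_all add: algebra_simps)
qed

section \<open>Powers of linear forms and the Veronese map\<close>

text \<open>\<open>h0, \<dots>, h4\<close> are the coefficients of a binary quartic form divided by the binomial coefficients,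
  so \<open>h\<^sub>j = g\<^bsup>4-j\<^esup> g'\<^bsup>j\<^esup>\<close> for the fourth power of the linear form \<open>(g, g')\<close>. The coordinates of
  \<open>\<real>\<^sup>5\<close> are chosen so that the Veronese map becomes the squaring of quadratic forms.\<close>

definition quartic_vec :: "real \<Rightarrow> real \<Rightarrow> real \<Rightarrow> real \<Rightarrow> real \<Rightarrow> real ^ 5" where
  "quartic_vec h0 h1 h2 h3 h4 = vector [3 / 2 * (h0 + 2 * h2 + h4), sqrt 3 / 2 * (6 * h2 - h0 - h4),
     2 * sqrt 3 * (h1 - h3), 2 * sqrt 3 * (h1 + h3), sqrt 3 * (h0 - h4)]"

text \<open>The right-hand side is six times the invariant pairing of quartic forms, so these
  coordinates carry that pairing to the metric of index 2.\<close>

lemma ip52_quartic_vec: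
  "ip52 (quartic_vec h0 h1 h2 h3 h4) (quartic_vec k0 k1 k2 k3 k4) =
     6 * (h0 * k4 + h4 * k0) - 24 * (h1 * k3 + h3 * k1) + 36 * h2 * k2"
proof -
  \<comment> \<open>With \<open>sqrt 3\<close> abstracted to \<open>r\<close>, the claim is a
    polynomial identity modulo \<open>r * r = 3\<close>.\<close>
  obtain r where r: "sqrt 3 = r" "r * r = (3::real)" by simp
  have "ip52 (quartic_vec h0 h1 h2 h3 h4) (quartic_vec k0 k1 k2 k3 k4) =
      9 / 4 * (h0 + 2 * h2 + h4) * (k0 + 2 * k2 + k4)
      + (r * r) * ((6 * h2 - h0 - h4) * (6 * k2 - k0 - k4) / 4 + 4 * (h1 - h3) * (k1 - k3)
        - 4 * (h1 + h3) * (k1 + k3) - (h0 - h4) * (k0 - k4))"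
    unfolding ip52_def quartic_vec_def vector_5 r(1) by (simp add: field_simps)
  then show ?thesis unfolding r(2) by (simp add: field_simps)
qed

lemma quartic_vec_add: "quartic_vec a0 a1 a2 a3 a4 + quartic_vec b0 b1 b2 b3 b4 =
    quartic_vec (a0 + b0) (a1 + b1) (a2 + b2) (a3 + b3) (a4 + b4)"
  and quartic_vec_scaleR: "c *\<^sub>R quartic_vec a0 a1 a2 a3 a4 =
    quartic_vec (c * a0) (c * a1) (c * a2) (c * a3) (c * a4)"
  by (simp_all add: quartic_vec_def vec_eq_iff forall_5 vector_5 field_simps)

lemma has_vector_derivative_quartic_vec:
  assumes "(h0 has_real_derivative h0') (at t)" "(h1 has_real_derivative h1') (at t)"
    "(h2 has_real_derivative h2') (at t)" "(h3 has_real_derivative h3') (at t)"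
    "(h4 has_real_derivative h4') (at t)"
  shows "((\<lambda>t. quartic_vec (h0 t) (h1 t) (h2 t) (h3 t) (h4 t)) has_vector_derivative
    quartic_vec h0' h1' h2' h3' h4') (at t)"
proof -
  have eq: "quartic_vec a0 a1 a2 a3 a4 = a0 *\<^sub>R quartic_vec 1 0 0 0 0 + a1 *\<^sub>R quartic_vec 0 1 0 0 0
    + a2 *\<^sub>R quartic_vec 0 0 1 0 0 + a3 *\<^sub>R quartic_vec 0 0 0 1 0 + a4 *\<^sub>R quartic_vec 0 0 0 0 1"
    for a0 a1 a2 a3 a4
    by (simp add: quartic_vec_add quartic_vec_scaleR)
  have d: "((\<lambda>t. h t *\<^sub>R v) has_vector_derivative h' *\<^sub>R v) (at t)"
    if "(h has_real_derivative h') (at t)" for h h' and v :: "real ^ 5"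
    using has_vector_derivative_scaleR[OF that has_vector_derivative_const] by simp
  show ?thesis
    unfolding eq[of "h0 _"] eq[of h0'] by (intro has_vector_derivative_add d assms)
qed

text \<open>The coefficients of the product of \<open>4 - k\<close> factors \<open>(g, g')\<close> and \<open>k\<close> factors \<open>(d, d')\<close>.\<close>

definition power_frame :: "real \<times> real \<Rightarrow> real \<times> real \<Rightarrow> nat \<Rightarrow> real ^ 5" where
  "power_frame = (\<lambda>(g, g') (d, d') k.
     if k = 0 then quartic_vec (g ^ 4) (g ^ 3 * g') (g\<^sup>2 * g'\<^sup>2) (g * g' ^ 3) (g' ^ 4)
     else if k = 1 then quartic_vec (g ^ 3 * d) ((g ^ 3 * d' + 3 * g\<^sup>2 * g' * d) / 4)
       ((g * g'\<^sup>2 * d + g\<^sup>2 * g' * d') / 2) ((g' ^ 3 * d + 3 * g * g'\<^sup>2 * d') / 4) (g' ^ 3 * d')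
     else if k = 2 then quartic_vec (g\<^sup>2 * d\<^sup>2) ((g\<^sup>2 * d * d' + g * g' * d\<^sup>2) / 2)
       ((g\<^sup>2 * d'\<^sup>2 + g'\<^sup>2 * d\<^sup>2 + 4 * g * g' * d * d') / 6)
       ((g'\<^sup>2 * d * d' + g * g' * d'\<^sup>2) / 2) (g'\<^sup>2 * d'\<^sup>2)
     else if k = 3 then quartic_vec (d ^ 3 * g) ((d ^ 3 * g' + 3 * d\<^sup>2 * d' * g) / 4)
       ((d * d'\<^sup>2 * g + d\<^sup>2 * d' * g') / 2) ((d' ^ 3 * g + 3 * d * d'\<^sup>2 * g') / 4) (d' ^ 3 * g')
     else quartic_vec (d ^ 4) (d ^ 3 * d') (d\<^sup>2 * d'\<^sup>2) (d * d' ^ 3) (d' ^ 4))"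

definition wedge :: "real \<times> real \<Rightarrow> real \<times> real \<Rightarrow> real" where
  "wedge g d = fst g * snd d - snd g * fst d"

text \<open>Substituting the linear forms \<open>g\<close>, \<open>d\<close> for \<open>X\<close>,
  \<open>Y\<close> multiplies the invariant pairing by the fourth power of their determinant; the 6
  is that of \<open>ip52_quartic_vec\<close>.\<close>

lemma apolar_basis_power_frame:
  "apolar_basis (6 * wedge g d ^ 4) (power_frame g d)"
proof -
  obtain g1 g2 d1 d2 where gd: "g = (g1, g2)" "d = (d1, d2)" by (cases g, cases d) auto
  show ?thesis
    unfolding apolar_basis_iff gd power_frame_def wedge_def
    by (simp add: ip52_quartic_vec)
      (intro conjI; simp add: field_simps power2_eq_square power3_eq_cube power4_eq_xxxx)
qed

text \<open>By the Leibniz rule each of the \<open>4 - k\<close> factors \<open>\<gamma>\<close> is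
  replaced by \<open>\<delta>\<close> in turn, and each of the \<open>k\<close> factors
  \<open>\<delta>\<close> by \<open>q \<gamma>\<close>.\<close>

lemma quartic_frame_power_frame:
  assumes \<gamma>: "\<And>t. t \<in> J \<Longrightarrow> (\<gamma> has_vector_derivative \<delta> t) (at t)"
    and \<delta>: "\<And>t. t \<in> J \<Longrightarrow> (\<delta> has_vector_derivative q t *\<^sub>R \<gamma> t) (at t)"
  shows "quartic_frame J q (\<lambda>k t. power_frame (\<gamma> t) (\<delta> t) k)"
proof -
  define g g' d d' where "g \<equiv> \<lambda>t. fst (\<gamma> t)" and "g' \<equiv> \<lambda>t. snd (\<gamma> t)"
    and "d \<equiv> \<lambda>t. fst (\<delta> t)" and "d' \<equiv> \<lambda>t. snd (\<delta> t)"
  have eq: "\<gamma> = (\<lambda>t. (g t, g' t))" "\<delta> = (\<lambda>t. (d t, d' t))"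
    by (simp_all add: g_def g'_def d_def d'_def)
  have der: "(g has_real_derivative d t) (at t)" "(g' has_real_derivative d' t) (at t)"
    "(d has_real_derivative q t * g t) (at t)" "(d' has_real_derivative q t * g' t) (at t)"
    if "t \<in> J" for t
    using bounded_linear.has_vector_derivative[OF bounded_linear_fst \<gamma>[OF that]]
      bounded_linear.has_vector_derivative[OF bounded_linear_snd \<gamma>[OF that]]
      bounded_linear.has_vector_derivative[OF bounded_linear_fst \<delta>[OF that]]
      bounded_linear.has_vector_derivative[OF bounded_linear_snd \<delta>[OF that]]
    by (simp_all add: has_real_derivative_iff_has_vector_derivative g_def g'_def d_def d'_def)
  show ?thesis
    unfolding quartic_frame_iff power_frame_def eq
    apply (simp add: quartic_vec_add quartic_vec_scaleR)
    apply (intro ballI conjI; rule has_vector_derivative_quartic_vec)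
    apply (auto intro!: derivative_eq_intros der simp: field_simps power_numeral_reduce)
    done
qed

section \<open>Quadratic forms and the pseudosphere\<close>

text \<open>If the product of the two linear forms is
  \<open>A X\<^sup>2 + B X Y + C Y\<^sup>2\<close>, the coordinates are \<open>sqrt 3\<close> times
  \<open>B\<close>, \<open>A - C\<close>, \<open>A + C\<close>. The Lorentzian square becomes three
  times the discriminant \<open>B\<^sup>2 - 4 A C\<close>, which for a product is the square of
  \<open>wedge g d\<close>.\<close>

definition linear_form_product :: "real \<times> real \<Rightarrow> real \<times> real \<Rightarrow> real ^ 3" where
  "linear_form_product g d = vector [sqrt 3 * (fst g * snd d + snd g * fst d),
     sqrt 3 * (fst g * fst d - snd g * snd d), sqrt 3 * (fst g * fst d + snd g * snd d)]"

lemma bounded_bilinear_linear_form_product: "bounded_bilinear linear_form_product"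
  unfolding bilinear_conv_bounded_bilinear[symmetric] bilinear_def linear_iff
  by (auto simp: linear_form_product_def vec_eq_iff forall_3 algebra_simps)

lemma linear_form_product_commute: "linear_form_product g d = linear_form_product d g"
  by (simp add: linear_form_product_def algebra_simps)

text \<open>Squaring \<open>g (d + c g)\<close> gives
  \<open>g\<^sup>2 d\<^sup>2 + 2 c g\<^sup>3 d + c\<^sup>2 g\<^sup>4\<close>; the three monomials
  are the frame vectors on the right.\<close>

lemma veronese_linear_form_product:
  "veronese_map (linear_form_product g (d + c *\<^sub>R g)) =
     power_frame g d 2 + (2 * c) *\<^sub>R power_frame g d 1 + c\<^sup>2 *\<^sub>R power_frame g d 0"
proof -
  obtain g1 g2 d1 d2 where gd: "g = (g1, g2)" "d = (d1, d2)" by (cases g, cases d) auto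
  have s: "(sqrt 3 * a)\<^sup>2 = 3 * a\<^sup>2" "(sqrt 3 * a) * (sqrt 3 * b) = 3 * (a * b)"
    "1 / (2 * sqrt 3) * (3 * a - 3 * b) = sqrt 3 / 2 * (a - b)"
    "1 / sqrt 3 * (3 * a) = sqrt 3 * a" for a b :: real
    by (simp_all add: power_mult_distrib field_simps)
  show ?thesis
    unfolding gd power_frame_def veronese_map_def linear_form_product_def Let_def vector_3 s
    by (simp add: quartic_vec_add quartic_vec_scaleR)
       (simp add: quartic_vec_def vec_eq_iff forall_5 vector_5 field_simps power2_eq_square power_numeral_reduce)
qed

lemma linear_form_product_pseudosphere:
  "r *\<^sub>R linear_form_product g d \<in> pseudosphere21 \<longleftrightarrow> r\<^sup>2 * (wedge g d)\<^sup>2 = 1"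
  by (auto simp: pseudosphere21_def linear_form_product_def wedge_def power2_eq_square algebra_simps)

text \<open>Here \<open>A, B, C\<close> are the coefficients of the quadratic form \<open>w\<close>; its coordinates with respect to
  \<open>g\<^sup>2, g d, d\<^sup>2\<close> are obtained by Cramer's rule when \<open>wedge g d = 1\<close>.\<close>

definition form_coords :: "real \<times> real \<Rightarrow> real \<times> real \<Rightarrow> real ^ 3 \<Rightarrow> real \<times> real \<times> real" where
  "form_coords g d w = (let A = (w $ 3 + w $ 2) / (2 * sqrt 3); B = w $ 1 / sqrt 3;
       C = (w $ 3 - w $ 2) / (2 * sqrt 3) in
     (A * (snd d)\<^sup>2 - B * fst d * snd d + C * (fst d)\<^sup>2,
      B * (fst g * snd d + snd g * fst d) - 2 * A * snd g * snd d - 2 * C * fst g * fst d,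
      A * (snd g)\<^sup>2 - B * fst g * snd g + C * (fst g)\<^sup>2))"

lemma form_coords_expand:
  assumes "wedge g d = 1" "form_coords g d w = (a, b, c)"
  shows "w = a *\<^sub>R linear_form_product g g + b *\<^sub>R linear_form_product g d
    + c *\<^sub>R linear_form_product d d"
proof -
  obtain g1 g2 d1 d2 where gd: "g = (g1, g2)" "d = (d1, d2)" by (cases g, cases d) auto
  define A B C where "A = (w $ 3 + w $ 2) / (2 * sqrt 3)" and "B = w $ 1 / sqrt 3"
    and "C = (w $ 3 - w $ 2) / (2 * sqrt 3)"
  have w: "w = vector [sqrt 3 * B, sqrt 3 * (A - C), sqrt 3 * (A + C)]"
    by (simp add: vec_eq_iff forall_3 vector_3 A_def B_def C_def field_simps)
  have det: "g1 * d2 - g2 * d1 = 1" using assms(1) by (simp add: gd wedge_def)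
  have abc: "a = A * d2\<^sup>2 - B * d1 * d2 + C * d1\<^sup>2"
    "b = B * (g1 * d2 + g2 * d1) - 2 * A * g2 * d2 - 2 * C * g1 * d1"
    "c = A * g2\<^sup>2 - B * g1 * g2 + C * g1\<^sup>2"
    using assms(2) by (auto simp: form_coords_def gd A_def B_def C_def Let_def)
  \<comment> \<open>Comparison of the coefficients of \<open>X\<^sup>2\<close>,
    \<open>Y\<^sup>2\<close> and \<open>X Y\<close>; by \<open>det\<close> Cramer's rule has no
    denominators.\<close>
  have ABC: "a * g1\<^sup>2 + b * (g1 * d1) + c * d1\<^sup>2 = A"
    "a * g2\<^sup>2 + b * (g2 * d2) + c * d2\<^sup>2 = C"
    "2 * a * g1 * g2 + b * (g1 * d2 + g2 * d1) + 2 * c * d1 * d2 = B"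
    using det unfolding abc by algebra+
  show ?thesis
    unfolding w gd ABC[symmetric]
    by (simp add: linear_form_product_def vec_eq_iff forall_3 vector_3)
       (simp add: power2_eq_square algebra_simps)
qed

lemma linear_form_coords: "linear (form_coords g d)"
  by (simp add: linear_iff form_coords_def Let_def add_divide_distrib diff_divide_distrib algebra_simps)

text \<open>Passing from the pseudosphere to the cone over it makes the image open in \<open>\<real>\<^sup>3\<close>, so that an open
  mapping theorem applies.\<close>

lemma open_cone_of_moving_forms:
  assumes J: "open J"
    and \<gamma>: "\<And>t. t \<in> J \<Longrightarrow> (\<gamma> has_vector_derivative \<delta> t) (at t)"
    and \<delta>: "\<And>t. t \<in> J \<Longrightarrow> (\<delta> has_vector_derivative q t *\<^sub>R \<gamma> t) (at t)"
    and det: "\<And>t. t \<in> J \<Longrightarrow> wedge (\<gamma> t) (\<delta> t) = 1"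
  shows "open ((\<lambda>(r, s, t). r *\<^sub>R linear_form_product (\<gamma> t) (\<delta> t + (s / 6) *\<^sub>R \<gamma> t)) `
    ({0<..} \<times> UNIV \<times> J))" (is "open (?\<Phi> ` ?T)")
proof -
  interpret L: bounded_bilinear linear_form_product by (rule bounded_bilinear_linear_form_product)
  define \<Phi> where "\<Phi> \<equiv> \<lambda>p. fst p *\<^sub>R linear_form_product (\<gamma> (snd (snd p)))
    (\<delta> (snd (snd p)) + (fst (snd p) / 6) *\<^sub>R \<gamma> (snd (snd p)))"
  have \<Phi>: "?\<Phi> = \<Phi>" by (auto simp: \<Phi>_def)
  define F where "F \<equiv> \<lambda>(r, s, t) (\<rho>, \<sigma>, \<tau>).
    \<rho> *\<^sub>R linear_form_product (\<gamma> t) (\<delta> t + (s / 6) *\<^sub>R \<gamma> t)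
    + r *\<^sub>R (linear_form_product (\<gamma> t) (\<tau> *\<^sub>R q t *\<^sub>R \<gamma> t + (s / 6) *\<^sub>R \<tau> *\<^sub>R \<delta> t + (\<sigma> / 6) *\<^sub>R \<gamma> t)
      + linear_form_product (\<tau> *\<^sub>R \<delta> t) (\<delta> t + (s / 6) *\<^sub>R \<gamma> t))"
  have T: "open ?T" using J by (intro open_Times) auto
  have der: "(\<Phi> has_derivative F p) (at p)" if "p \<in> ?T" for p
  proof -
    have t: "snd (snd p) \<in> J" using that by auto
    have snd2: "((\<lambda>p. snd (snd p)) has_derivative (\<lambda>h. snd (snd h))) (at p)"
      by (intro derivative_intros)
    have d: "((\<lambda>p. \<gamma> (snd (snd p))) has_derivative (\<lambda>h. snd (snd h) *\<^sub>R \<delta> (snd (snd p)))) (at p)"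
      "((\<lambda>p. \<delta> (snd (snd p))) has_derivative (\<lambda>h. snd (snd h) *\<^sub>R q (snd (snd p)) *\<^sub>R \<gamma> (snd (snd p)))) (at p)"
      using has_derivative_compose[OF snd2 \<gamma>[OF t, unfolded has_vector_derivative_def]]
        has_derivative_compose[OF snd2 \<delta>[OF t, unfolded has_vector_derivative_def]]
      by auto
    have s: "((\<lambda>p::real \<times> real \<times> real. fst (snd p) / 6) has_derivative (\<lambda>h. fst (snd h) / 6)) (at p)"
      by (auto intro!: derivative_eq_intros)
    have f: "(fst has_derivative fst) (at p)" by (intro derivative_intros)
    show ?thesis
      unfolding \<Phi>_def
      by (rule has_derivative_eq_rhs, (rule has_derivative_scaleR L.FDERIV has_derivative_add d s f)+)
        (auto simp: F_def fun_eq_iff split_beta algebra_simps)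
  qed
  have "\<Phi> p \<in> interior (\<Phi> ` ?T)" if p: "p \<in> ?T" for p
  proof -
    obtain r s t where rst: "p = (r, s, t)" by (cases p) auto
    have r: "r > 0" and t: "t \<in> J" using p rst by auto
    \<comment> \<open>Solves \<open>F p (\<rho>, \<sigma>, \<tau>) = w\<close> in the basis
      \<open>\<gamma>\<^sup>2, \<gamma> \<delta>, \<delta>\<^sup>2\<close>, where the system is
      triangular: the last coordinate gives \<open>\<tau>\<close>, the middle one
      \<open>\<rho>\<close>, the first one \<open>\<sigma>\<close>.\<close>
    define G where "G \<equiv> \<lambda>w. let (a, b, c) = form_coords (\<gamma> t) (\<delta> t) w; \<rho> = b - s / 3 * c in
      (\<rho>, 6 / r * (a - q t * c - s / 6 * \<rho>), c / r)"
    have "linear G"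
      using linear_add[OF linear_form_coords] linear_scale[OF linear_form_coords] r
      by (auto simp: linear_iff G_def Let_def split_beta field_simps)
    then have G: "bounded_linear G" by (rule linear_conv_bounded_linear[THEN iffD1])
    have "F p (G w) = w" for w
    proof -
      obtain a b c where abc: "form_coords (\<gamma> t) (\<delta> t) w = (a, b, c)"
        by (metis prod_cases3)
      have "F p (G w) = a *\<^sub>R linear_form_product (\<gamma> t) (\<gamma> t)
          + b *\<^sub>R linear_form_product (\<gamma> t) (\<delta> t) + c *\<^sub>R linear_form_product (\<delta> t) (\<delta> t)"
        using r
        by (simp add: F_def G_def rst abc Let_def L.add_right L.add_left L.scaleR_left L.scaleR_right
            linear_form_product_commute[of "\<delta> t" "\<gamma> t"])
          (simp add: vec_eq_iff field_simps)
      then show ?thesis using form_coords_expand[OF det[OF t] abc] by simp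
    qed
    then have "F p \<circ> G = id" by (auto simp: fun_eq_iff)
    moreover have "continuous_on ?T \<Phi>"
      by (intro continuous_at_imp_continuous_on ballI has_derivative_continuous[OF der])
    moreover have "p \<in> interior ?T" using p T by (simp add: interior_open)
    \<comment> \<open>Besides continuity of \<open>\<Phi>\<close>, this theorem asks for a right
      inverse of the derivative at \<open>p\<close> alone. This matters because \<open>q\<close> is
      arbitrary here, so \<open>F\<close> may depend discontinuously on the point.\<close>
    ultimately show ?thesis
      using sussmann_open_mapping[OF T _ p der[OF p] G _ order_refl] by blast
  qed
  then show ?thesis unfolding \<Phi> by (metis image_subsetI interior_subset open_interior subset_antisym)
qed

section \<open>Openness of the Veronese map onto its image\<close>

lemma veronese_map_minus: "veronese_map (- p) = veronese_map p"
  by (simp add: veronese_map_def Let_def)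

text \<open>On the pseudosphere the Veronese image \<open>u\<close> of \<open>p\<close> determines the symmetric matrix of the products
  \<open>p\<^sub>i p\<^sub>j\<close>; this is that matrix, applied to a vector.\<close>

definition symmetric_action :: "real ^ 5 \<Rightarrow> real ^ 3 \<Rightarrow> real ^ 3" where
  "symmetric_action u p = vector
     [(u $ 1 + 1 + sqrt 3 * u $ 2) * p $ 1 + sqrt 3 * u $ 3 * p $ 2 + sqrt 3 * u $ 4 * p $ 3,
      sqrt 3 * u $ 3 * p $ 1 + (u $ 1 + 1 - sqrt 3 * u $ 2) * p $ 2 + sqrt 3 * u $ 5 * p $ 3,
      sqrt 3 * u $ 4 * p $ 1 + sqrt 3 * u $ 5 * p $ 2 + (2 * u $ 1 - 1) * p $ 3]"

text \<open>The equation of the pseudosphere turns the first coordinate of the image into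
  \<open>((p $ 3)\<^sup>2 + 1) / 2\<close>. This yields the third square and the sum of the other
  two, which the second coordinate separates; so the matrix has rank one.\<close>

lemma symmetric_action_veronese:
  assumes "p \<in> pseudosphere21"
  shows "symmetric_action (veronese_map p) v = (p \<bullet> v) *\<^sub>R p"
proof -
  let ?u = "veronese_map p"
  have s: "sqrt 3 * (1 / (2 * sqrt 3) * y) = y / 2" "sqrt 3 * (1 / sqrt 3 * y) = y" for y :: real
    by simp_all
  have u: "?u $ 1 + 1 + sqrt 3 * ?u $ 2 = (p $ 1)\<^sup>2" "?u $ 1 + 1 - sqrt 3 * ?u $ 2 = (p $ 2)\<^sup>2"
    "2 * ?u $ 1 - 1 = (p $ 3)\<^sup>2" "sqrt 3 * ?u $ 3 = p $ 1 * p $ 2"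
    "sqrt 3 * ?u $ 4 = p $ 1 * p $ 3" "sqrt 3 * ?u $ 5 = p $ 2 * p $ 3"
    using assms unfolding veronese_map_def Let_def vector_5 s
    by (simp_all add: pseudosphere21_def field_simps)
  show ?thesis
    unfolding symmetric_action_def u
    by (simp add: vec_eq_iff forall_3 vector_3 inner_vec_def sum_3 algebra_simps power2_eq_square)
qed

lemma continuous_symmetric_action: "continuous_on S (\<lambda>u. symmetric_action u p)"
proof -
  have "symmetric_action u p =
      ((u $ 1 + 1 + sqrt 3 * u $ 2) * p $ 1 + sqrt 3 * u $ 3 * p $ 2 + sqrt 3 * u $ 4 * p $ 3) *\<^sub>R axis 1 1
    + (sqrt 3 * u $ 3 * p $ 1 + (u $ 1 + 1 - sqrt 3 * u $ 2) * p $ 2 + sqrt 3 * u $ 5 * p $ 3) *\<^sub>R axis 2 1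
    + (sqrt 3 * u $ 4 * p $ 1 + sqrt 3 * u $ 5 * p $ 2 + (2 * u $ 1 - 1) * p $ 3) *\<^sub>R axis 3 1" for u
    by (simp add: symmetric_action_def vec_eq_iff forall_3 vector_3 axis_def)
  then show ?thesis
    by (simp only:) (intro continuous_intros)
qed

text \<open>Normalizing \<open>symmetric_action u p\<close> gives a continuous local section of the Veronese map near its
  value at \<open>p\<close>, up to the antipodal ambiguity.\<close>

lemma openin_veronese_image:
  assumes "openin (top_of_set pseudosphere21) W"
  shows "openin (top_of_set lorentzian_veronese_surface) (veronese_map ` W)"
proof (subst openin_subopen, intro ballI)
  obtain G where G: "open G" "W = pseudosphere21 \<inter> G"
    using assms by (auto simp: openin_open)
  fix u assume "u \<in> veronese_map ` W"
  then obtain p where p: "p \<in> W" "u = veronese_map p" by blast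
  have p0: "p \<noteq> 0" using p G by (auto simp: pseudosphere21_def)
  define w where "w \<equiv> \<lambda>u. symmetric_action u p"
  define h where "h \<equiv> \<lambda>u. (1 / sqrt (p \<bullet> w u)) *\<^sub>R w u"
  have w: "w (veronese_map p') = (p' \<bullet> p) *\<^sub>R p'" if "p' \<in> pseudosphere21" for p'
    using symmetric_action_veronese[OF that] by (simp add: w_def)
  have cw: "continuous_on S w" for S
    unfolding w_def by (rule continuous_symmetric_action)
  \<comment> \<open>At \<open>u = veronese_map p'\<close> the quantity is the square of
    \<open>p' \<bullet> p\<close>, so on the surface \<open>P\<close> discards just the images of
    points orthogonal to \<open>p\<close>.\<close>
  define P where "P = {u. 0 < p \<bullet> w u}"
  have "open P"
    unfolding P_def by (intro open_Collect_less continuous_intros cw)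
  moreover have "continuous_on P h"
    unfolding h_def by (intro continuous_intros cw) (auto simp: P_def)
  ultimately have T: "open (P \<inter> h -` G)"
    using G(1) by (metis continuous_on_open_vimage Int_commute)
  show "\<exists>T. openin (top_of_set lorentzian_veronese_surface) T \<and> u \<in> T \<and> T \<subseteq> veronese_map ` W"
  proof (intro exI conjI)
    show "openin (top_of_set lorentzian_veronese_surface) (lorentzian_veronese_surface \<inter> (P \<inter> h -` G))"
      using T by (rule openin_open_Int)
    have pp: "p \<bullet> w u = (p \<bullet> p)\<^sup>2" "w u = (p \<bullet> p) *\<^sub>R p"
      using w[of p] p G by (auto simp: power2_eq_square)
    have "p \<bullet> p > 0" using p0 by simp
    then show "u \<in> lorentzian_veronese_surface \<inter> (P \<inter> h -` G)"
      using p G pp by (auto simp: lorentzian_veronese_surface_def P_def h_def)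
    show "lorentzian_veronese_surface \<inter> (P \<inter> h -` G) \<subseteq> veronese_map ` W"
    proof
      fix u' assume u': "u' \<in> lorentzian_veronese_surface \<inter> (P \<inter> h -` G)"
      then obtain p' where p': "p' \<in> pseudosphere21" "u' = veronese_map p'"
        by (auto simp: lorentzian_veronese_surface_def)
      let ?c = "p' \<bullet> p"
      have "p \<bullet> w u' = ?c\<^sup>2"
        by (simp add: p' w power2_eq_square inner_commute)
      then have h: "h u' = (?c / \<bar>?c\<bar>) *\<^sub>R p'" and "?c \<noteq> 0"
        using u' by (auto simp: h_def w p' P_def)
      then have "h u' = p' \<or> h u' = - p'" by (auto simp: abs_if)
      moreover have "h u' \<in> G" using u' by simp
      \<comment> \<open>\<open>G\<close> may fail to be symmetric, so \<open>h u' \<in> G\<close>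
        may select \<open>- p'\<close> instead of \<open>p'\<close>; both have the same
        image.\<close>
      moreover have "- p' \<in> pseudosphere21" using p' by (simp add: pseudosphere21_def)
      ultimately have "p' \<in> W \<or> - p' \<in> W" using p' G by auto
      then show "u' \<in> veronese_map ` W"
        using p' veronese_map_minus by (metis imageI)
    qed
  qed
qed

text \<open>Adding a multiple of \<open>\<gamma> t\<close> to \<open>\<delta> t\<close> keeps the
  determinant 1, so \<open>r = 1\<close> is the only positive factor that leaves a product on the
  pseudosphere. The image is thus the section of the open cone by the pseudosphere.\<close>

lemma openin_moving_forms:
  assumes "open J" "\<And>t. t \<in> J \<Longrightarrow> (\<gamma> has_vector_derivative \<delta> t) (at t)"
    and "\<And>t. t \<in> J \<Longrightarrow> (\<delta> has_vector_derivative q t *\<^sub>R \<gamma> t) (at t)"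
    and det: "\<And>t. t \<in> J \<Longrightarrow> wedge (\<gamma> t) (\<delta> t) = 1"
  shows "openin (top_of_set pseudosphere21)
    ((\<lambda>(s, t). linear_form_product (\<gamma> t) (\<delta> t + (s / 6) *\<^sub>R \<gamma> t)) ` (UNIV \<times> J))" (is "openin _ (?P ` _)")
proof -
  let ?\<Phi> = "\<lambda>(r, s, t). r *\<^sub>R linear_form_product (\<gamma> t) (\<delta> t + (s / 6) *\<^sub>R \<gamma> t)"
  have wedge: "wedge (\<gamma> t) (\<delta> t + (s / 6) *\<^sub>R \<gamma> t) = 1" if "t \<in> J" for s t
    using det[OF that] by (simp add: wedge_def algebra_simps)
  have mem: "r *\<^sub>R linear_form_product (\<gamma> t) (\<delta> t + (s / 6) *\<^sub>R \<gamma> t) \<in> pseudosphere21 \<longleftrightarrow> r = 1"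
    if "t \<in> J" "r > 0" for r s t
    using that by (simp add: linear_form_product_pseudosphere wedge power2_eq_1_iff)
  have "?P ` (UNIV \<times> J) = pseudosphere21 \<inter> ?\<Phi> ` ({0<..} \<times> UNIV \<times> J)"
  proof (intro equalityI subsetI)
    fix y assume "y \<in> ?P ` (UNIV \<times> J)"
    then obtain s t where "t \<in> J" "y = ?\<Phi> (1, s, t)" by auto
    then show "y \<in> pseudosphere21 \<inter> ?\<Phi> ` ({0<..} \<times> UNIV \<times> J)"
      using mem[of t 1 s] by (auto intro!: image_eqI[of _ _ "(1, s, t)"])
  next
    fix y assume y: "y \<in> pseudosphere21 \<inter> ?\<Phi> ` ({0<..} \<times> UNIV \<times> J)"
    then obtain r s t where "t \<in> J" "r > 0" "y = ?\<Phi> (r, s, t)" by auto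
    moreover from this have "r = 1" using mem y by auto
    ultimately show "y \<in> ?P ` (UNIV \<times> J)" by (auto intro!: image_eqI[of _ _ "(s, t)"])
  qed
  then show ?thesis
    using open_cone_of_moving_forms[OF assms] by (simp add: openin_open_Int)
qed

text \<open>The Wronskian is constant since the equation has no first-order term; the initial
  vectors \<open>(1, 0)\<close> and \<open>(0, 1)\<close> make it 1.\<close>

lemma unimodular_solution:
  fixes q :: "real \<Rightarrow> real"
  assumes "open I" "continuous_on I q" "t0 \<in> I"
  obtains h \<gamma> \<delta> where "h > 0" "{t0 - h<..<t0 + h} \<subseteq> I"
    and "\<And>t. t \<in> {t0 - h<..<t0 + h} \<Longrightarrow> (\<gamma> has_vector_derivative \<delta> t) (at t)"
    and "\<And>t. t \<in> {t0 - h<..<t0 + h} \<Longrightarrow> (\<delta> has_vector_derivative q t *\<^sub>R \<gamma> t) (at t)"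
    and "\<And>t. t \<in> {t0 - h<..<t0 + h} \<Longrightarrow> wedge (\<gamma> t) (\<delta> t) = 1"
proof -
  obtain h and \<gamma> \<delta> :: "real \<Rightarrow> real \<times> real" where h: "h > 0" "{t0 - h<..<t0 + h} \<subseteq> I"
    and init: "\<gamma> t0 = (1, 0)" "\<delta> t0 = (0, 1)"
    and d: "\<And>t. t \<in> {t0 - h<..<t0 + h} \<Longrightarrow> (\<gamma> has_vector_derivative \<delta> t) (at t)"
      "\<And>t. t \<in> {t0 - h<..<t0 + h} \<Longrightarrow> (\<delta> has_vector_derivative q t *\<^sub>R \<gamma> t) (at t)"
    using second_order_linear_ode_local[OF assms] by metis
  have "bilinear wedge"
    by (auto simp: bilinear_def linear_iff wedge_def algebra_simps)
  then interpret w: bounded_bilinear wedge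
    by (simp add: bilinear_conv_bounded_bilinear)
  have "wedge (\<gamma> t) (\<delta> t) = wedge (\<gamma> t0) (\<delta> t0)" if "t \<in> {t0 - h<..<t0 + h}" for t
  proof (rule has_derivative_zero_unique[of "{t0 - h<..<t0 + h}" "\<lambda>t. wedge (\<gamma> t) (\<delta> t)"])
    fix r assume r: "r \<in> {t0 - h<..<t0 + h}"
    have "((\<lambda>t. wedge (\<gamma> t) (\<delta> t)) has_vector_derivative 0) (at r)"
      using w.has_vector_derivative[OF d[OF r]] by (simp add: wedge_def)
    then show "((\<lambda>t. wedge (\<gamma> t) (\<delta> t)) has_derivative (\<lambda>_. 0)) (at r within {t0 - h<..<t0 + h})"
      by (simp add: has_vector_derivative_def has_derivative_at_withinI)
  qed (use that h in auto)
  then have "wedge (\<gamma> t) (\<delta> t) = 1" if "t \<in> {t0 - h<..<t0 + h}" for t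
    using that by (simp add: init wedge_def)
  with h d show thesis by (rule that)
qed

section \<open>The congruence\<close>

lemma nth_vderiv_Suc: "nth_vderiv (Suc n) f t = vector_derivative (nth_vderiv n f) (at t)"
  by (simp add: nth_vderiv_def)

lemma smooth_curve_has_vector_derivative:
  assumes "smooth_curve_on I f" "t \<in> I"
  shows "(nth_vderiv n f has_vector_derivative nth_vderiv (Suc n) f t) (at t)"
  using assms by (simp add: smooth_curve_on_def nth_vderiv_Suc vector_derivative_works)

theorem proposition3p7:
  fixes I :: "real set" and \<alpha> :: "real \<Rightarrow> real ^ 5"
    and \<eta> \<xi> :: "real \<Rightarrow> real" and x :: "real \<times> real \<Rightarrow> real ^ 5"
  defines "\<eta> \<equiv> \<lambda>t. ip52 (nth_vderiv 3 \<alpha> t) (nth_vderiv 3 \<alpha> t)"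
    and "\<xi> \<equiv> \<lambda>t. ip52 (nth_vderiv 4 \<alpha> t) (nth_vderiv 4 \<alpha> t)"
    and "x \<equiv> \<lambda>(s, t). (1 / 2 * s\<^sup>2 + 27 / 40 * ip52 (nth_vderiv 3 \<alpha> t) (nth_vderiv 3 \<alpha> t)) *\<^sub>R \<alpha> t
           + (3 / 2 * s) *\<^sub>R nth_vderiv 1 \<alpha> t + (3 / 2) *\<^sub>R nth_vderiv 2 \<alpha> t"
  assumes "open I" and "is_interval I"
    and "null_curve_on I \<alpha>"
    and "\<forall>t\<in>I. \<alpha> t \<in> light_cone"
    and "\<forall>t\<in>I. ip52 (nth_vderiv 2 \<alpha> t) (nth_vderiv 2 \<alpha> t) = 4 / 9"
    and "\<forall>t\<in>I. 27 / 40 * nth_vderiv 2 \<eta> t - 5103 / 1600 * (\<eta> t)\<^sup>2 + 27 / 16 * \<xi> t = 0"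
  shows "locally_congruent52 x (UNIV \<times> I) lorentzian_veronese_surface"
proof -
  define a where "a \<equiv> \<lambda>n. nth_vderiv n \<alpha>"
  have a0: "a 0 = \<alpha>" by (simp add: a_def nth_vderiv_def)
  have da: "(a n has_vector_derivative a (Suc n) t) (at t)" if "t \<in> I" for n t
    using smooth_curve_has_vector_derivative[of I \<alpha> t n] that \<open>null_curve_on I \<alpha>\<close>
    by (simp add: a_def null_curve_on_def)
  have dip: "((\<lambda>t. ip52 (a j t) (a k t)) has_vector_derivative
      ip52 (a j t) (a (Suc k) t) + ip52 (a (Suc j) t) (a k t)) (at t)" if "t \<in> I" for j k t
    by (rule ip52.has_vector_derivative[OF da[OF that] da[OF that]])
  have \<eta>1: "nth_vderiv 1 \<eta> t = 2 * ip52 (a 3 t) (a 4 t)" if "t \<in> I" for t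
  proof -
    have "nth_vderiv 0 \<eta> = (\<lambda>t. ip52 (a 3 t) (a 3 t))"
      by (simp add: nth_vderiv_def[of 0] \<eta>_def a_def)
    then show ?thesis
      using vector_derivative_at[OF dip[OF that, of 3 3]] nth_vderiv_Suc[of 0 \<eta> t]
      by (simp add: ip52_commute[of "a 4 t" "a 3 t"])
  qed
  have \<eta>2: "nth_vderiv 2 \<eta> t = 2 * ip52 (a 4 t) (a 4 t) + 2 * ip52 (a 3 t) (a 5 t)" if "t \<in> I" for t
  proof -
    have "((\<lambda>t. 2 * ip52 (a 3 t) (a 4 t)) has_vector_derivative
        2 * (ip52 (a 3 t) (a 5 t) + ip52 (a 4 t) (a 4 t))) (at t)"
      using has_vector_derivative_mult_right[OF dip[OF that, of 3 4], of 2] by simp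
    then have "(nth_vderiv 1 \<eta> has_vector_derivative
        2 * (ip52 (a 3 t) (a 5 t) + ip52 (a 4 t) (a 4 t))) (at t)"
      by (rule has_vector_derivative_transform_within_open[OF _ \<open>open I\<close> that]) (simp only: \<eta>1)
    from vector_derivative_at[OF this] show ?thesis
      using nth_vderiv_Suc[of 1 \<eta> t] by (simp add: numeral_2_eq_2)
  qed
  define q where "q \<equiv> \<lambda>t. - 9 / 80 * ip52 (a 3 t) (a 3 t)"
  have null: "ip52 (a 0 t) (a 0 t) = 0" "ip52 (a 1 t) (a 1 t) = 0" "ip52 (a 2 t) (a 2 t) = 4 / 9"
    if "t \<in> I" for t
    using assms that unfolding a0 by (auto simp: light_cone_def null_curve_on_def a_def)
  have curv: "27 / 40 * (2 * ip52 (a 4 t) (a 4 t) + 2 * ip52 (a 3 t) (a 5 t))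
      - 5103 / 1600 * (ip52 (a 3 t) (a 3 t))\<^sup>2 + 27 / 16 * ip52 (a 4 t) (a 4 t) = 0" if "t \<in> I" for t
    using bspec[OF assms(9) that] unfolding \<eta>2[OF that] by (simp add: \<eta>_def \<xi>_def a_def)
  obtain e where e: "quartic_frame I q e"
    and ap: "\<And>t. t \<in> I \<Longrightarrow> apolar_basis (1 / 54) (\<lambda>k. e k t)"
    and ae: "\<And>t. t \<in> I \<Longrightarrow> a 0 t = e 0 t" "\<And>t. t \<in> I \<Longrightarrow> a 1 t = 4 *\<^sub>R e 1 t"
      "\<And>t. t \<in> I \<Longrightarrow> a 2 t = 12 *\<^sub>R e 2 t + (4 * q t) *\<^sub>R e 0 t"
    by (rule quartic_frame_of_null_curve[where a = a and q = q])
      ((rule \<open>open I\<close> meta_eq_to_obj_eq[OF q_def]) | (rule da null curv, assumption) | (rule that; simp))+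
  \<comment> \<open>The term \<open>27 / 40 * \<eta> t\<close> is \<open>- 6 * q t\<close> and
    cancels the \<open>e 0\<close> part of \<open>(3 / 2) *\<^sub>R a 2 t\<close>. What is left is
    18 times the expansion in \<open>veronese_linear_form_product\<close> with
    \<open>c = s / 6\<close>.\<close>
  have x: "x (s, t) = 18 *\<^sub>R e 2 t + (6 * s) *\<^sub>R e 1 t + (s\<^sup>2 / 2) *\<^sub>R e 0 t" if "t \<in> I" for s t
  proof -
    have "x (s, t) = (1 / 2 * s\<^sup>2 - 6 * q t) *\<^sub>R a 0 t + (3 / 2 * s) *\<^sub>R a 1 t + (3 / 2) *\<^sub>R a 2 t"
      unfolding a0 by (simp add: x_def q_def a_def)
    then show ?thesis
      unfolding ae[OF that] by (simp add: vec_eq_iff field_simps)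
  qed
  have "continuous_on I q"
    unfolding q_def
    by (intro continuous_at_imp_continuous_on ballI continuous_intros
        has_vector_derivative_continuous[OF dip])
  show ?thesis
    unfolding locally_congruent52_def
  proof
    fix p assume "p \<in> (UNIV :: real set) \<times> I"
    then obtain s0 t0 where p: "p = (s0, t0)" "t0 \<in> I" by blast
    obtain h \<gamma> \<delta> where h: "h > 0" "{t0 - h<..<t0 + h} \<subseteq> I"
      and \<gamma>: "\<And>t. t \<in> {t0 - h<..<t0 + h} \<Longrightarrow> (\<gamma> has_vector_derivative \<delta> t) (at t)"
      and \<delta>: "\<And>t. t \<in> {t0 - h<..<t0 + h} \<Longrightarrow> (\<delta> has_vector_derivative q t *\<^sub>R \<gamma> t) (at t)"
      and det: "\<And>t. t \<in> {t0 - h<..<t0 + h} \<Longrightarrow> wedge (\<gamma> t) (\<delta> t) = 1"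
      using unimodular_solution[OF \<open>open I\<close> \<open>continuous_on I q\<close> p(2)] by metis
    define J where "J = {t0 - h<..<t0 + h}"
    note \<gamma> = \<gamma>[folded J_def] and \<delta> = \<delta>[folded J_def] and det = det[folded J_def]
    have J: "open J" "convex J" "t0 \<in> J" "J \<subseteq> I" using h by (auto simp: J_def)
    define E where "E \<equiv> \<lambda>k t. power_frame (\<gamma> t) (\<delta> t) k"
    have eJ: "quartic_frame J q e" using e J by (auto simp: quartic_frame_def)
    have EJ: "quartic_frame J q E"
      unfolding E_def using \<gamma> \<delta> by (rule quartic_frame_power_frame)
    have apE: "apolar_basis 6 (\<lambda>k. E k t)" if "t \<in> J" for t
      using apolar_basis_power_frame[of "\<gamma> t" "\<delta> t"] det[OF that] by (simp add: E_def)
    \<comment> \<open>The frame constants \<open>1 / 54\<close> and \<open>6\<close> have product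
      \<open>1 / 9\<close>, whence the factor 3. As \<open>3 * (1 / 54) = 1 / 18\<close>, the 18 in
      \<open>x\<close> is cancelled too.\<close>
    define A where "A \<equiv> \<lambda>v. 3 *\<^sub>R frame_map (\<lambda>k. e k t0) (\<lambda>k. E k t0) v"
    have "ip52 (A v) (A w) = ip52 v w" for v w
      using ip52_frame_map[OF ap _ apE, of t0 t0 v w] J p(2) by (simp add: A_def ip52_linear)
    moreover have "linear A"
      unfolding A_def by (intro linear_compose_scale_right linear_frame_map)
    ultimately have iso: "linear_isometry52 A" by (simp add: linear_isometry52_def)
    have Ae: "A (e 0 t) = (1 / 18) *\<^sub>R E 0 t" "A (e 1 t) = (1 / 18) *\<^sub>R E 1 t"
      "A (e 2 t) = (1 / 18) *\<^sub>R E 2 t" if t: "t \<in> J" for t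
    proof -
      \<comment> \<open>The frames at \<open>t0\<close> may be replaced by those at
        \<open>t\<close>, so one isometry serves all of \<open>J\<close>.\<close>
      have "A v = 3 *\<^sub>R frame_map (\<lambda>k. e k t) (\<lambda>k. E k t) v" for v
        unfolding A_def using frame_map_constant[OF J(2) eJ EJ J(3) t] by simp
      then show "A (e 0 t) = (1 / 18) *\<^sub>R E 0 t" "A (e 1 t) = (1 / 18) *\<^sub>R E 1 t"
        "A (e 2 t) = (1 / 18) *\<^sub>R E 2 t"
        using frame_map_basis[OF ap, of t] t J by auto
    qed
    have Ax: "A (x (s, t)) = veronese_map (linear_form_product (\<gamma> t) (\<delta> t + (s / 6) *\<^sub>R \<gamma> t))"
      if t: "t \<in> J" for s t
    proof -
      have tI: "t \<in> I" using t J by auto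
      show ?thesis
        unfolding x[OF tI] veronese_linear_form_product linear_add[OF \<open>linear A\<close>]
          linear_scale[OF \<open>linear A\<close>] Ae[OF t]
        by (simp add: E_def power2_eq_square)
    qed
    show "\<exists>U A. openin (top_of_set (UNIV \<times> I)) U \<and> p \<in> U \<and> linear_isometry52 A \<and>
        openin (top_of_set lorentzian_veronese_surface) (A ` x ` U)"
    proof (intro exI conjI)
      show "openin (top_of_set (UNIV \<times> I)) (UNIV \<times> J)"
        using J by (intro open_subset open_Times) auto
      show "p \<in> UNIV \<times> J" using p J by simp
      show "linear_isometry52 A" by fact
      have "A ` x ` (UNIV \<times> J) = veronese_map `
          (\<lambda>(s, t). linear_form_product (\<gamma> t) (\<delta> t + (s / 6) *\<^sub>R \<gamma> t)) ` (UNIV \<times> J)"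
        unfolding image_image by (rule image_cong) (auto simp: Ax)
      then show "openin (top_of_set lorentzian_veronese_surface) (A ` x ` (UNIV \<times> J))"
        using openin_veronese_image[OF openin_moving_forms[OF J(1) \<gamma> \<delta> det]] by simp
    qed
  qed
qed

end
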